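(* Let $f$ be a non-constant SAGE signomial in $n\ge 2$ variables that is invariant under the action of $\mathcal{S}_n$. If the zero set $V_{\mathbb{R}}(f)=\{x\in\mathbb{R}^n:f(x)=0\}$ is non-empty, then there are three possibilities: (1) $V_{\mathbb{R}}(f)$ is a singleton on the diagonal. (2) $V_{\mathbb{R}}(f)$ is the diagonal. (3) $V_{\mathbb{R}}(f)$ is an affine hyperplane of the form $\{x\in\mathbb{R}^n:\sum_{i=1}^n x_i=\tau\}$ for some constant $\tau\in\mathbb{R}$. In particular, if a non-constant SAGE signomial in $n\ge 2$ variables that is invariant under the action of $\mathcal{S}_n$ has a zero, then it has at least one zero on the diagonal.
   Context: $\mathcal{S}_n$ denotes the symmetric group, which acts on signomials in $n$ variables by permuting the variables. The diagonal is $\{(t,\ldots,t):t\in\mathbb{R}\}\subset\mathbb{R}^n$. For a finite set $\mathcal{A}\subset\mathbb{R}^n$ and $\beta\in\mathbb{R}^n\setminus\mathcal{A}$, $C_{\mathrm{AGE}}(\mathcal{A},\beta)$ is the set of signomials $\sum_{\alpha\in\mathcal{A}}c_\alpha e^{\langle\alpha,x\rangle}+c_\beta e^{\langle\beta,x\rangle}$ with $c_\alpha\ge0$ for $\alpha\in\mathcal{A}$, $c_\beta\in\mathbb{R}$, that are nonnegative on $\mathbb{R}^n$. A SAGE signomial is an element of $C_{\mathrm{SAGE}}(\mathcal{T})=\sum_{\beta\in\mathcal{T}}C_{\mathrm{AGE}}(\mathcal{T}\setminus\{\beta\},\beta)$ for some nonempty finite $\mathcal{T}\subset\mathbb{R}^n$.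 *)

theory Defs
  imports "HOL-Analysis.Analysis" "HOL-Combinatorics.Permutations"
begin

text \<open>Signomials in \<open>n = CARD('n)\<close> variables are represented as real functions on \<open>real ^ 'n\<close>. Exponentials
  with distinct exponent vectors are linearly independent, so this loses no information about the
  coefficients.\<close>

definition C_AGE :: "(real ^ 'n::finite) set \<Rightarrow> real ^ 'n \<Rightarrow> (real ^ 'n \<Rightarrow> real) set" where
  "C_AGE A \<beta> = {f. \<exists>(c :: real ^ 'n \<Rightarrow> real) (c\<^sub>\<beta> :: real).
      (\<forall>\<alpha>\<in>A. 0 \<le> c \<alpha>) \<and>
      f = (\<lambda>x. (\<Sum>\<alpha>\<in>A. c \<alpha> * exp (\<alpha> \<bullet> x)) + c\<^sub>\<beta> * exp (\<beta> \<bullet> x)) \<and>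
      (\<forall>x. 0 \<le> f x)}"

text \<open>The Minkowski sum of the cones \<open>C_AGE (T - {\<beta>}) \<beta>\<close> over \<open>\<beta> \<in> T\<close>.\<close>

definition C_SAGE :: "(real ^ 'n::finite) set \<Rightarrow> (real ^ 'n \<Rightarrow> real) set" where
  "C_SAGE T = {f. \<exists>g :: real ^ 'n \<Rightarrow> real ^ 'n \<Rightarrow> real.
      (\<forall>\<beta>\<in>T. g \<beta> \<in> C_AGE (T - {\<beta>}) \<beta>) \<and> f = (\<lambda>x. \<Sum>\<beta>\<in>T. g \<beta> x)}"

definition sage_signomial :: "(real ^ 'n::finite \<Rightarrow> real) \<Rightarrow> bool" where
  "sage_signomial f \<longleftrightarrow> (\<exists>T. finite T \<and> T \<noteq> {} \<and> f \<in> C_SAGE T)"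

definition symmetric_invariant :: "(real ^ 'n::finite \<Rightarrow> real) \<Rightarrow> bool" where
  "symmetric_invariant f \<longleftrightarrow> (\<forall>\<sigma>. \<sigma> permutes UNIV \<longrightarrow> (\<lambda>x. f (\<chi> i. x $ \<sigma> i)) = f)"

definition real_zeros :: "(real ^ 'n::finite \<Rightarrow> real) \<Rightarrow> (real ^ 'n) set" where
  "real_zeros f = {x. f x = 0}"

definition diagonal :: "(real ^ 'n::finite) set" where
  "diagonal = {(\<chi> i. t) | t :: real. True}"

end

theory Submission
  imports Defs
begin

text \<open>A signomial in an AGE cone, divided by its distinguished exponential, is a nonnegative
  combination of exponentials of linear forms plus a constant, hence convex; it is
  nonnegative because the signomial is. Two of its zeros are therefore two minimizers, and strict
  convexity of \<open>exp\<close> forces every linear form that occurs with nonzero coefficient to agree at them; it is then constant on the whole line through them, and so is the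
  quotient. Thus the zero set of an AGE signomial is affine (\<open>affine_zeros_C_AGE\<close>). A SAGE
  signomial is a sum of nonnegative functions, so its zero set is the intersection of the zero sets
  of its summands and is affine as well (\<open>affine_real_zeros_sage\<close>).

  It remains to classify the nonempty affine sets \<open>V\<close> that are stable under permuting coordinates
  (\<open>permutation_stable_affine_cases\<close>). If \<open>V\<close> lies in the diagonal, which is a line, it is a point
  or the diagonal. Otherwise some \<open>x \<in> V\<close> has two distinct coordinates, and subtracting from \<open>x\<close>
  its image under the corresponding transposition gives a direction of \<open>V\<close> proportional to a
  difference of two coordinate vectors. The permuted copies of that direction span all vectors of
  coordinate sum zero, so \<open>V\<close> contains a hyperplane on which the coordinate sum is fixed. Hence it
  is that hyperplane or the whole space, and the latter would make the signomial constant. Such a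
  hyperplane meets the diagonal, so a zero on the diagonal exists in every case.\<close>

section \<open>Zero sets of AGE and SAGE signomials\<close>

text \<open>The difference of the two sides is half the square of \<open>exp (a / 2) - exp (b / 2)\<close>.\<close>

lemma exp_midpoint_le:
  fixes a b :: real
  shows "exp ((a + b) / 2) \<le> (exp a + exp b) / 2"
    and "exp ((a + b) / 2) = (exp a + exp b) / 2 \<longleftrightarrow> a = b"
proof -
  have e: "exp ((a + b) / 2) = exp (a / 2) * exp (b / 2)"
    by (simp add: exp_add[symmetric] add_divide_distrib)
  have s: "exp a = (exp (a / 2))\<^sup>2" "exp b = (exp (b / 2))\<^sup>2"
    by (simp_all add: exp_double[symmetric])
  have gap: "(exp a + exp b) / 2 - exp ((a + b) / 2) = (exp (a / 2) - exp (b / 2))\<^sup>2 / 2"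
    unfolding e s by (simp add: power2_eq_square algebra_simps add_divide_distrib)
  show "exp ((a + b) / 2) \<le> (exp a + exp b) / 2"
    using gap zero_le_power2[of "exp (a / 2) - exp (b / 2)"] by linarith
  show "exp ((a + b) / 2) = (exp a + exp b) / 2 \<longleftrightarrow> a = b"
  proof
    assume "exp ((a + b) / 2) = (exp a + exp b) / 2"
    then have "(exp (a / 2) - exp (b / 2))\<^sup>2 = 0" using gap by linarith
    then show "a = b" by simp
  qed simp
qed

text \<open>Equality in midpoint convexity transfers to each summand because the defects are
  nonnegative, while their sum is minus the value at the midpoint and so at most zero.\<close>

lemma exp_sum_zeros_forms_eq:
  fixes p q :: "'a \<Rightarrow> real"
  assumes "finite A" and c: "\<And>\<alpha>. \<alpha> \<in> A \<Longrightarrow> 0 \<le> c \<alpha>"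
    and zp: "(\<Sum>\<alpha>\<in>A. c \<alpha> * exp (p \<alpha>)) + d = 0"
    and zq: "(\<Sum>\<alpha>\<in>A. c \<alpha> * exp (q \<alpha>)) + d = 0"
    and mid: "0 \<le> (\<Sum>\<alpha>\<in>A. c \<alpha> * exp ((p \<alpha> + q \<alpha>) / 2)) + d"
    and \<alpha>: "\<alpha> \<in> A"
  shows "c \<alpha> = 0 \<or> p \<alpha> = q \<alpha>"
proof -
  define gap where "gap \<alpha> = c \<alpha> * ((exp (p \<alpha>) + exp (q \<alpha>)) / 2 - exp ((p \<alpha> + q \<alpha>) / 2))" for \<alpha>
  have nonneg: "0 \<le> gap \<alpha>" if "\<alpha> \<in> A" for \<alpha>
    unfolding gap_def using c[OF that] exp_midpoint_le(1)[of "p \<alpha>" "q \<alpha>"] by simp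
  have "(\<Sum>\<alpha>\<in>A. gap \<alpha>) = ((\<Sum>\<alpha>\<in>A. c \<alpha> * exp (p \<alpha>)) + (\<Sum>\<alpha>\<in>A. c \<alpha> * exp (q \<alpha>))) / 2
      - (\<Sum>\<alpha>\<in>A. c \<alpha> * exp ((p \<alpha> + q \<alpha>) / 2))"
    unfolding gap_def
    by (simp add: right_diff_distrib sum_subtractf distrib_left sum.distrib sum_divide_distrib
        add_divide_distrib)
  also have "\<dots> = - ((\<Sum>\<alpha>\<in>A. c \<alpha> * exp ((p \<alpha> + q \<alpha>) / 2)) + d)"
    using zp zq by (simp add: eq_neg_iff_add_eq_0[symmetric])
  also have "\<dots> \<le> 0" using mid by simp
  finally have "(\<Sum>\<alpha>\<in>A. gap \<alpha>) = 0"
    using sum_nonneg[of A gap] nonneg by force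
  then have "gap \<alpha> = 0"
    using sum_nonneg_eq_0_iff[of A gap] \<open>finite A\<close> nonneg \<alpha> by blast
  then show ?thesis
    unfolding gap_def using exp_midpoint_le(2)[of "p \<alpha>" "q \<alpha>"] by auto
qed

lemma affine_zeros_C_AGE:
  fixes g :: "real ^ 'n::finite \<Rightarrow> real"
  assumes "finite A" and g: "g \<in> C_AGE A \<beta>"
  shows "affine (real_zeros g)"
proof -
  from g obtain c d where c: "\<And>\<alpha>. \<alpha> \<in> A \<Longrightarrow> 0 \<le> c \<alpha>"
    and g_eq: "g = (\<lambda>x. (\<Sum>\<alpha>\<in>A. c \<alpha> * exp (\<alpha> \<bullet> x)) + d * exp (\<beta> \<bullet> x))"
    and g_nonneg: "\<And>x. 0 \<le> g x"
    unfolding C_AGE_def by blast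
  define h where "h x = (\<Sum>\<alpha>\<in>A. c \<alpha> * exp ((\<alpha> - \<beta>) \<bullet> x)) + d" for x
  have g_h: "g x = exp (\<beta> \<bullet> x) * h x" for x
    unfolding g_eq h_def
    by (simp add: distrib_left sum_distrib_left inner_diff_left exp_diff)
  have zero_iff: "x \<in> real_zeros g \<longleftrightarrow> h x = 0" for x
    unfolding real_zeros_def g_h by simp
  have h_nonneg: "0 \<le> h x" for x
    using g_nonneg[of x] unfolding g_h by (simp add: zero_le_mult_iff)
  have "u *\<^sub>R x + v *\<^sub>R y \<in> real_zeros g"
    if "x \<in> real_zeros g" "y \<in> real_zeros g" and uv: "u + v = 1" for x y u v
  proof -
    have hx: "h x = 0" and hy: "h y = 0" using that zero_iff by auto
    have "0 \<le> (\<Sum>\<alpha>\<in>A. c \<alpha> * exp (((\<alpha> - \<beta>) \<bullet> x + (\<alpha> - \<beta>) \<bullet> y) / 2)) + d"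
      using h_nonneg[of "(1/2) *\<^sub>R (x + y)"]
      by (simp add: h_def inner_add_right)
    note forms = exp_sum_zeros_forms_eq[OF \<open>finite A\<close> c hx[unfolded h_def] hy[unfolded h_def] this]
    have "c \<alpha> * exp ((\<alpha> - \<beta>) \<bullet> (u *\<^sub>R x + v *\<^sub>R y)) = c \<alpha> * exp ((\<alpha> - \<beta>) \<bullet> x)"
      if "\<alpha> \<in> A" for \<alpha>
    proof (cases "c \<alpha> = 0")
      case False
      then have "(\<alpha> - \<beta>) \<bullet> y = (\<alpha> - \<beta>) \<bullet> x" using forms[OF _ that] by simp
      then have "(\<alpha> - \<beta>) \<bullet> (u *\<^sub>R x + v *\<^sub>R y) = (u + v) * ((\<alpha> - \<beta>) \<bullet> x)"
        unfolding inner_add_right inner_scaleR_right by (simp only: distrib_right)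
      then show ?thesis using uv by simp
    qed simp
    then have "h (u *\<^sub>R x + v *\<^sub>R y) = h x"
      unfolding h_def by (metis (no_types, lifting) sum.cong)
    then show ?thesis using hx zero_iff by simp
  qed
  then show ?thesis unfolding affine_def by blast
qed

lemma affine_real_zeros_sage:
  assumes "sage_signomial f"
  shows "affine (real_zeros f)"
proof -
  from assms obtain T g where "finite T"
    and g: "\<And>\<beta>. \<beta> \<in> T \<Longrightarrow> g \<beta> \<in> C_AGE (T - {\<beta>}) \<beta>"
    and f: "f = (\<lambda>x. \<Sum>\<beta>\<in>T. g \<beta> x)"
    unfolding sage_signomial_def C_SAGE_def by blast
  have nonneg: "0 \<le> g \<beta> x" if "\<beta> \<in> T" for \<beta> x
    using g[OF that] unfolding C_AGE_def by blast
  have "real_zeros f = \<Inter> ((\<lambda>\<beta>. real_zeros (g \<beta>)) ` T)"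
    unfolding real_zeros_def f using \<open>finite T\<close> nonneg
    by (auto simp: sum_nonneg_eq_0_iff)
  moreover have "affine \<dots>"
    by (rule affine_Inter) (auto intro!: affine_zeros_C_AGE[OF _ g] \<open>finite T\<close>)
  ultimately show ?thesis by simp
qed

section \<open>Affine sets stable under permuting coordinates\<close>

definition permute_coords :: "('n \<Rightarrow> 'n) \<Rightarrow> real ^ 'n::finite \<Rightarrow> real ^ 'n" where
  "permute_coords \<sigma> x = (\<chi> i. x $ \<sigma> i)"

lemma permute_coords_nth [simp]: "permute_coords \<sigma> x $ i = x $ \<sigma> i"
  by (simp add: permute_coords_def)

text \<open>Subtracting from \<open>v\<close> its image under the transposition of \<open>i\<close> and \<open>j\<close> isolates
  \<open>axis i 1 - axis j 1\<close> up to a nonzero factor. Moving \<open>j\<close> to an arbitrary \<open>k\<close> yields the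
  differences \<open>axis i 1 - axis k 1\<close>, which span the vectors of coordinate sum zero.\<close>

lemma zero_sum_mem_transpose_stable_subspace:
  fixes L :: "(real ^ 'n::finite) set"
  assumes L: "subspace L"
    and stable: "\<And>a b w. w \<in> L \<Longrightarrow> permute_coords (Transposition.transpose a b) w \<in> L"
    and v: "v \<in> L" "v $ i \<noteq> v $ j"
    and w: "(\<Sum>k\<in>UNIV. w $ k) = 0"
  shows "w \<in> L"
proof -
  have ij: "i \<noteq> j" using v by auto
  have "v - permute_coords (Transposition.transpose i j) v
      = (v $ i - v $ j) *\<^sub>R (axis i 1 - axis j 1)"
    using ij by (auto simp: vec_eq_iff axis_def Transposition.transpose_def)
  then have "(v $ i - v $ j) *\<^sub>R (axis i 1 - axis j 1) \<in> L"
    using subspace_diff[OF L v(1) stable[OF v(1)]] by metis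
  then have "(1 / (v $ i - v $ j)) *\<^sub>R ((v $ i - v $ j) *\<^sub>R (axis i 1 - axis j 1)) \<in> L"
    by (rule subspace_mul[OF L])
  then have dij: "axis i 1 - axis j 1 \<in> L" using v(2) by simp
  have dik: "axis i 1 - axis k 1 \<in> L" for k
  proof (cases "k = i")
    case True
    then show ?thesis using subspace_0[OF L] by simp
  next
    case False
    then have "permute_coords (Transposition.transpose j k) (axis i 1 - axis j 1)
        = axis i 1 - axis k 1"
      using ij by (auto simp: vec_eq_iff axis_def Transposition.transpose_def)
    then show ?thesis using stable[OF dij] by metis
  qed
  have "(\<Sum>k\<in>UNIV. (- (w $ k)) *\<^sub>R (axis i 1 - axis k 1))
      = (\<Sum>k\<in>UNIV. w $ k *\<^sub>R axis k 1) - (\<Sum>k\<in>UNIV. w $ k) *\<^sub>R axis i 1"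
    by (simp add: scaleR_diff_right sum_subtractf sum_negf scaleR_sum_left)
  also have "\<dots> = w"
    using basis_expansion[of w] w by (simp add: scalar_mult_eq_scaleR)
  finally have "w = (\<Sum>k\<in>UNIV. (- (w $ k)) *\<^sub>R (axis i 1 - axis k 1))" by simp
  moreover have "\<dots> \<in> L"
    by (intro subspace_sum[OF L] subspace_mul[OF L] dik)
  ultimately show ?thesis by simp
qed

lemma affine_subset_diagonal_cases:
  fixes V :: "(real ^ 'n::finite) set"
  assumes V: "affine V" "V \<noteq> {}" and sub: "V \<subseteq> diagonal"
  shows "(\<exists>x\<in>diagonal. V = {x}) \<or> V = diagonal"
proof -
  obtain x where x: "x \<in> V" using V by blast
  show ?thesis
  proof (cases "V = {x}")
    case True
    then show ?thesis using sub by blast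
  next
    case False
    then obtain y where y: "y \<in> V" "y \<noteq> x" using x by blast
    obtain s t where s: "x = (\<chi> i. s)" and t: "y = (\<chi> i. t)"
      using sub x y unfolding diagonal_def by blast
    have st: "t \<noteq> s" using y s t by auto
    have "(\<chi> i. r) \<in> V" for r
    proof -
      \<comment> \<open>The parameter at which the affine line from \<open>s\<close> to \<open>t\<close> reaches \<open>r\<close>.\<close>
      let ?u = "(r - s) / (t - s)"
      have "(1 - ?u) *\<^sub>R x + ?u *\<^sub>R y \<in> V"
        using V(1) x y(1) unfolding affine_alt by blast
      moreover have "(1 - ?u) * s + ?u * t = s + ?u * (t - s)"
        by (simp only: algebra_simps)
      then have "(1 - ?u) *\<^sub>R x + ?u *\<^sub>R y = (\<chi> i. r)"
        unfolding s t using st by (simp add: vec_eq_iff)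
      ultimately show ?thesis by simp
    qed
    then have "diagonal \<subseteq> V" unfolding diagonal_def by blast
    then show ?thesis using sub by blast
  qed
qed

lemma permutation_stable_affine_cases:
  fixes V :: "(real ^ 'n::finite) set"
  assumes V: "affine V" "V \<noteq> {}"
    and stable: "\<And>a b x. x \<in> V \<Longrightarrow> permute_coords (Transposition.transpose a b) x \<in> V"
  shows "(\<exists>x\<in>diagonal. V = {x}) \<or> V = diagonal
    \<or> (\<exists>\<tau>. V = {x. (\<Sum>i\<in>UNIV. x $ i) = \<tau>}) \<or> V = UNIV"
proof (cases "V \<subseteq> diagonal")
  case True
  then show ?thesis using affine_subset_diagonal_cases[OF V] by blast
next
  case False
  then obtain x where x: "x \<in> V" "x \<notin> diagonal" by blast
  obtain i j where ij: "x $ i \<noteq> x $ j"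
  proof (rule ccontr)
    assume "\<not> thesis"
    then have "x = (\<chi> i. x $ undefined)" using that by (auto simp: vec_eq_iff)
    then show False using x(2) unfolding diagonal_def by blast
  qed
  define L where "L = (\<lambda>y. - x + y) ` V"
  have L_iff: "w \<in> L \<longleftrightarrow> x + w \<in> V" for w
    unfolding L_def by (auto intro!: image_eqI[where x = "x + w"])
  have L: "subspace L"
    unfolding L_def using affine_diffs_subspace[OF V(1) x(1)] by simp
  have L_stable: "permute_coords (Transposition.transpose a b) w \<in> L" if "w \<in> L" for a b w
  proof -
    let ?P = "permute_coords (Transposition.transpose a b)"
    have "?P (x + w) - x \<in> L" "?P x - x \<in> L"
      using stable that x(1) by (simp_all add: L_iff)
    from subspace_diff[OF L this] have "?P (x + w) - ?P x \<in> L" by simp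
    moreover have "?P (x + w) - ?P x = ?P w" by (simp add: vec_eq_iff)
    ultimately show ?thesis by simp
  qed
  \<comment> \<open>The transposition negates \<open>v\<close>, so its entries at \<open>i\<close> and \<open>j\<close> are opposite and nonzero.\<close>
  define v where "v = permute_coords (Transposition.transpose i j) x - x"
  have v: "v \<in> L" using stable[OF x(1)] by (simp add: L_iff v_def)
  have vij: "v $ i \<noteq> v $ j" using ij by (simp add: v_def)
  have zero_sum: "w \<in> L" if "(\<Sum>k\<in>UNIV. w $ k) = 0" for w
    using zero_sum_mem_transpose_stable_subspace[OF L L_stable v vij that] .
  define \<tau> where "\<tau> = (\<Sum>k\<in>UNIV. x $ k)"
  have sup: "{y. (\<Sum>k\<in>UNIV. y $ k) = \<tau>} \<subseteq> V"
  proof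
    fix y :: "real ^ 'n"
    assume "y \<in> {y. (\<Sum>k\<in>UNIV. y $ k) = \<tau>}"
    then have "y - x \<in> L" by (intro zero_sum) (simp add: sum_subtractf \<tau>_def)
    then show "y \<in> V" by (simp add: L_iff)
  qed
  show ?thesis
  proof (cases "V \<subseteq> {y. (\<Sum>k\<in>UNIV. y $ k) = \<tau>}")
    case True
    then show ?thesis using sup by blast
  next
    case False
    then obtain y where y: "y \<in> V" "(\<Sum>k\<in>UNIV. y $ k) \<noteq> \<tau>" by blast
    have "z \<in> V" for z
    proof -
      \<comment> \<open>The multiple of \<open>y - x\<close> whose coordinate sum is that of \<open>z - x\<close>.\<close>
      define t where "t = ((\<Sum>k\<in>UNIV. z $ k) - \<tau>) / ((\<Sum>k\<in>UNIV. y $ k) - \<tau>)"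
      have "(\<Sum>k\<in>UNIV. (z - x - t *\<^sub>R (y - x)) $ k)
          = (\<Sum>k\<in>UNIV. z $ k) - \<tau> - t * ((\<Sum>k\<in>UNIV. y $ k) - \<tau>)"
        by (simp add: sum_subtractf \<tau>_def flip: sum_distrib_left)
      also have "\<dots> = 0" using y(2) by (simp add: t_def)
      finally have "z - x - t *\<^sub>R (y - x) \<in> L" by (rule zero_sum)
      moreover have "t *\<^sub>R (y - x) \<in> L"
        using y(1) by (intro subspace_mul[OF L]) (simp add: L_iff)
      ultimately have "z - x - t *\<^sub>R (y - x) + t *\<^sub>R (y - x) \<in> L"
        by (rule subspace_add[OF L])
      then show ?thesis by (simp add: L_iff)
    qed
    then show ?thesis by blast
  qed
qed

section \<open>Zeros of symmetric SAGE signomials\<close>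

theorem lemma3p1:
  fixes f :: "real ^ 'n::finite \<Rightarrow> real"
  assumes "CARD('n) \<ge> 2"
    and "sage_signomial f"
    and "\<not> f constant_on UNIV"
    and "symmetric_invariant f"
    and "real_zeros f \<noteq> {}"
  shows "((\<exists>x\<in>diagonal. real_zeros f = {x})
       \<or> real_zeros f = diagonal
       \<or> (\<exists>\<tau>::real. real_zeros f = {x. (\<Sum>i\<in>UNIV. x $ i) = \<tau>}))
       \<and> (\<exists>x\<in>diagonal. f x = 0)"
proof
  have "permute_coords (Transposition.transpose a b) x \<in> real_zeros f"
    if "x \<in> real_zeros f" for a b x
  proof -
    have "(\<lambda>x. f (\<chi> i. x $ Transposition.transpose a b i)) = f"
      using assms(4) permutes_swap_id[of a UNIV b] unfolding symmetric_invariant_def by blast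
    from fun_cong[OF this, of x] show ?thesis
      using that by (simp add: real_zeros_def permute_coords_def)
  qed
  moreover have "real_zeros f \<noteq> UNIV"
    using assms(3) unfolding real_zeros_def constant_on_def by blast
  ultimately show cases: "(\<exists>x\<in>diagonal. real_zeros f = {x}) \<or> real_zeros f = diagonal
      \<or> (\<exists>\<tau>::real. real_zeros f = {x. (\<Sum>i\<in>UNIV. x $ i) = \<tau>})"
    using permutation_stable_affine_cases[OF affine_real_zeros_sage[OF assms(2)] assms(5)] by blast
  have "(\<exists>x\<in>diagonal. x \<in> real_zeros f)"
    using cases
  proof (elim disjE)
    assume "\<exists>x\<in>diagonal. real_zeros f = {x}"
    then show ?thesis by blast
  next
    assume "real_zeros f = diagonal"
    then show ?thesis using assms(5) by blast
  next
    assume "\<exists>\<tau>. real_zeros f = {x. (\<Sum>i\<in>UNIV. x $ i) = \<tau>}"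
    then obtain \<tau> where \<tau>: "real_zeros f = {x. (\<Sum>i\<in>UNIV. x $ i) = \<tau>}" by blast
    let ?x = "\<chi> i::'n. \<tau> / real CARD('n)"
    have "?x \<in> real_zeros f" unfolding \<tau> by simp
    moreover have "?x \<in> diagonal" unfolding diagonal_def by blast
    ultimately show ?thesis by blast
  qed
  then show "\<exists>x\<in>diagonal. f x = 0" unfolding real_zeros_def by blast
qed

end
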